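(* Let $q$ be a prime power. Let $\mathcal{C}_{in}$ be an $[n_1,k_1,d_1;r]_q$-locally repairable code and let $\mathcal{C}_{out}$ be an $[n_2,k_2,d_2]_{q^{k_1}}$-linear code. Then one can concatenate $\mathcal{C}_{in}$ (as inner code) with $\mathcal{C}_{out}$ (as outer code) to obtain an $[n_1n_2,\,k_1k_2,\,\ge d_1d_2;\,r]_q$-locally repairable code; namely, for any $\mathbb{F}_q$-vector space isomorphism $\varphi:\mathbb{F}_{q^{k_1}}\to\mathcal{C}_{in}$, the code $\mathcal{C}_{conc}=\{(\varphi(c_1),\dots,\varphi(c_{n_2})):(c_1,\dots,c_{n_2})\in\mathcal{C}_{out}\}\subseteq\mathbb{F}_q^{n_1n_2}$ has these parameters.
   Context: An $[n,k,d]_q$-linear code is a $k$-dimensional $\mathbb{F}_q$-subspace $\mathcal{C}\neq\{0\}$ of $\mathbb{F}_q^n$ whose minimum Hamming distance is $d$; writing $\ge d$ in place of $d$ means the minimum distance is at least $d$. A linear code $\mathcal{C}\subseteq\mathbb{F}_q^n$ has locality $r$ if for every $i\in[n]=\{1,\dots,n\}$ there is a set $R\subseteq[n]\setminus\{i\}$ with $|R|\le r$ such that for all $\mathbf{u},\mathbf{v}\in\mathcal{C}$: $\mathbf{u}_{R\cup\{i\}}=\mathbf{v}_{R\cup\{i\}}$ if and only if $\mathbf{u}_R=\mathbf{v}_R$. Equivalently, for every $i\in[n]$ there is a codeword $\mathbf{c}$ of the dual code $\mathcal{C}^\perp$ with $i\in\mathrm{supp}(\mathbf{c})$ and $|\mathrm{supp}(\mathbf{c})|\le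 r+1$. An $[n,k,d;r]_q$-locally repairable code is an $[n,k,d]_q$-linear code with locality $r$. *)

theory Defs
  imports "HOL-Analysis.Cartesian_Space" "HOL-Number_Theory.Prime_Powers"
begin

text \<open>
  A code over the finite field \<open>'a\<close> is a subset of \<open>'a ^ 'n\<close>. The coordinate set $[n]$ is rendered by
  an arbitrary finite index type \<open>'n\<close> with \<open>CARD('n) = n\<close>; index types are nonempty, which loses
  nothing since codes are required to be nonzero.
\<close>

definition hamming_dist :: "'a ^ 'n::finite \<Rightarrow> 'a ^ 'n \<Rightarrow> nat"
  where "hamming_dist u v = card {i. u $ i \<noteq> v $ i}"

text \<open>The set below is finite, and it is nonempty as soon as \<open>C\<close> has two elements.\<close>

definition min_dist :: "('a ^ 'n::finite) set \<Rightarrow> nat"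
  where "min_dist C = Min {hamming_dist u v | u v. u \<in> C \<and> v \<in> C \<and> u \<noteq> v}"

definition linear_code_of_dim :: "nat \<Rightarrow> nat \<Rightarrow> nat \<Rightarrow> ('a::field ^ 'n::finite) set \<Rightarrow> bool"
  where "linear_code_of_dim q n k C \<longleftrightarrow>
    CARD('a) = q \<and> CARD('n) = n \<and> vec.subspace C \<and> C \<noteq> {0} \<and> vec.dim C = k"

text \<open>$[n,k,d]_q$- and $[n,k,\ge d]_q$-linear codes.\<close>

definition linear_code :: "nat \<Rightarrow> nat \<Rightarrow> nat \<Rightarrow> nat \<Rightarrow> ('a::field ^ 'n::finite) set \<Rightarrow> bool"
  where "linear_code q n k d C \<longleftrightarrow> linear_code_of_dim q n k C \<and> min_dist C = d"

definition linear_code_ge :: "nat \<Rightarrow> nat \<Rightarrow> nat \<Rightarrow> nat \<Rightarrow> ('a::field ^ 'n::finite) set \<Rightarrow> bool"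
  where "linear_code_ge q n k d C \<longleftrightarrow> linear_code_of_dim q n k C \<and> min_dist C \<ge> d"

definition agree_on :: "'n set \<Rightarrow> 'a ^ 'n::finite \<Rightarrow> 'a ^ 'n \<Rightarrow> bool"
  where "agree_on S u v \<longleftrightarrow> (\<forall>j\<in>S. u $ j = v $ j)"

definition has_locality :: "nat \<Rightarrow> ('a ^ 'n::finite) set \<Rightarrow> bool"
  where "has_locality r C \<longleftrightarrow>
    (\<forall>i. \<exists>R. R \<subseteq> UNIV - {i} \<and> card R \<le> r \<and>
      (\<forall>u\<in>C. \<forall>v\<in>C. agree_on (R \<union> {i}) u v \<longleftrightarrow> agree_on R u v))"

text \<open>$[n,k,d;r]_q$- and $[n,k,\ge d;r]_q$-locally repairable codes.\<close>

definition lrc :: "nat \<Rightarrow> nat \<Rightarrow> nat \<Rightarrow> nat \<Rightarrow> nat \<Rightarrow> ('a::field ^ 'n::finite) set \<Rightarrow> bool"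
  where "lrc q n k d r C \<longleftrightarrow> linear_code q n k d C \<and> has_locality r C"

definition lrc_ge :: "nat \<Rightarrow> nat \<Rightarrow> nat \<Rightarrow> nat \<Rightarrow> nat \<Rightarrow> ('a::field ^ 'n::finite) set \<Rightarrow> bool"
  where "lrc_ge q n k d r C \<longleftrightarrow> linear_code_ge q n k d C \<and> has_locality r C"

text \<open>
  An extension of fields is given by an embedding \<open>\<iota>\<close> of the small field into the large one, through
  which the large field is a vector space over the small one.
\<close>

definition field_embedding :: "('a::field \<Rightarrow> 'b::field) \<Rightarrow> bool"
  where "field_embedding \<iota> \<longleftrightarrow>
    \<iota> 1 = 1 \<and> (\<forall>x y. \<iota> (x + y) = \<iota> x + \<iota> y) \<and> (\<forall>x y. \<iota> (x * y) = \<iota> x * \<iota> y)"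

definition extension_iso ::
    "('a::field \<Rightarrow> 'b::field) \<Rightarrow> ('a ^ 'n::finite) set \<Rightarrow> ('b \<Rightarrow> 'a ^ 'n) \<Rightarrow> bool"
  where "extension_iso \<iota> C \<phi> \<longleftrightarrow>
    Vector_Spaces.linear (\<lambda>a x. \<iota> a * x) (*s) \<phi> \<and> bij_betw \<phi> UNIV C"

text \<open>Coordinate \<open>(j, i)\<close> of the concatenated word is the \<open>i\<close>-th coordinate of its \<open>j\<close>-th block.\<close>

definition concat_word :: "('b \<Rightarrow> 'a ^ 'n) \<Rightarrow> 'b ^ 'm \<Rightarrow> 'a ^ ('m::finite \<times> 'n::finite)"
  where "concat_word \<phi> c = (\<chi> p. \<phi> (c $ fst p) $ snd p)"

definition concat_code :: "('b \<Rightarrow> 'a ^ 'n) \<Rightarrow> ('b ^ 'm) set \<Rightarrow> ('a ^ ('m::finite \<times> 'n::finite)) set"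
  where "concat_code \<phi> C = {concat_word \<phi> c | c. c \<in> C}"

end

theory Submission
  imports Defs
begin

text \<open>
  Dimensions are found by counting: a subspace of dimension \<open>k\<close> over a field with \<open>q\<close> elements has
  \<open>q ^ k\<close> elements, and concatenation is injective, so it preserves the number of codewords. For the
  distance, every block in which two outer codewords differ contributes at least the inner minimum
  distance. A repair set of an inner coordinate, moved into the corresponding block, is a repair set
  of the concatenated coordinate.
\<close>

section \<open>Counting in vector spaces\<close>

context vector_space
begin

text \<open>Each new basis vector \<open>b\<close> multiplies the count by \<open>CARD('a)\<close>,
  because every element of the larger span is \<open>scale a b + x\<close> for exactly one scalar
  \<open>a\<close> and one \<open>x\<close> in the old span. Over an infinite field the equation
  still holds, as \<open>card\<close> is 0 on infinite sets.\<close>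

lemma card_span_independent:
  assumes "finite B" "independent B"
  shows "card (span B) = CARD('a) ^ card B"
  using assms
proof (induction B rule: finite_induct)
  case empty
  then show ?case by simp
next
  case (insert b B)
  have b: "b \<notin> span B" and indep: "independent B"
    using insert.prems insert.hyps by (auto simp: independent_insert)
  have "bij_betw (\<lambda>(a, x). scale a b + x) (UNIV \<times> span B) (span (insert b B))"
  proof (rule bij_betwI')
    fix p p' :: "'a \<times> 'b"
    assume "p \<in> UNIV \<times> span B" "p' \<in> UNIV \<times> span B"
    then obtain a x a' x' where p: "p = (a, x)" "p' = (a', x')"
      and x: "x \<in> span B" "x' \<in> span B"
      by auto
    have "a = a' \<and> x = x'" if eq: "scale a b + x = scale a' b + x'"
    proof -
      have "scale (a - a') b = x' - x"
        using eq by (simp add: scale_left_diff_distrib algebra_simps)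
      then have sp: "scale (a - a') b \<in> span B"
        using x by (simp add: span_diff)
      have "a = a'"
      \<comment> \<open>Otherwise \<open>a - a'\<close> is invertible, and dividing by it would put
        \<open>b\<close> into \<open>span B\<close>.\<close>
      proof (rule ccontr)
        assume "a \<noteq> a'"
        then have "b = scale (inverse (a - a')) (scale (a - a') b)"
          by simp
        with span_scale[OF sp, of "inverse (a - a')"] b show False
          by simp
      qed
      with eq show ?thesis by simp
    qed
    then show "(case p of (a, x) \<Rightarrow> scale a b + x) = (case p' of (a, x) \<Rightarrow> scale a b + x)
        \<longleftrightarrow> p = p'"
      using p by auto
  next
    fix p :: "'a \<times> 'b"
    assume "p \<in> UNIV \<times> span B"
    then show "(case p of (a, x) \<Rightarrow> scale a b + x) \<in> span (insert b B)"
      by (auto simp: span_insert intro: exI[of _ "fst p"])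
  next
    fix y
    assume "y \<in> span (insert b B)"
    then obtain k where "y - scale k b \<in> span B"
      by (auto simp: span_insert)
    then show "\<exists>p\<in>UNIV \<times> span B. y = (case p of (a, x) \<Rightarrow> scale a b + x)"
      by (intro bexI[of _ "(k, y - scale k b)"]) auto
  qed
  then have "card (span (insert b B)) = card (UNIV \<times> span B :: ('a \<times> 'b) set)"
    by (simp add: bij_betw_same_card)
  then show ?case
    using insert.IH[OF indep] insert.hyps by (simp add: card_cartesian_product)
qed

end

lemma (in finite_dimensional_vector_space) card_subspace:
  assumes "subspace V"
  shows "card V = CARD('a) ^ dim V"
proof -
  obtain B where B: "B \<subseteq> V" "independent B" "V \<subseteq> span B" "card B = dim V"
    using basis_exists by blast
  have "span B = V"
    using B assms by (simp add: span_subspace)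
  moreover have "finite B"
    using B by (simp add: finiteI_independent)
  ultimately show ?thesis
    using card_span_independent[of B] B by simp
qed

section \<open>Field extensions\<close>

lemma field_embedding_vector_space:
  fixes \<iota> :: "'a::field \<Rightarrow> 'b::field"
  assumes "field_embedding \<iota>"
  shows "vector_space (\<lambda>a x. \<iota> a * x)"
  using assms by unfold_locales (auto simp: field_embedding_def algebra_simps)

text \<open>Equal cardinalities force equal dimensions over the small field, and spaces of equal
  finite dimension are isomorphic.\<close>

lemma extension_iso_exists:
  fixes \<iota> :: "'a::field \<Rightarrow> 'b::field" and C :: "('a ^ 'n::finite) set"
  assumes \<iota>: "field_embedding \<iota>" and C: "vec.subspace C"
    and q: "CARD('a) > 1" and card: "CARD('b) = CARD('a) ^ vec.dim C"
  shows "\<exists>\<phi>. extension_iso \<iota> C \<phi>"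
proof -
  interpret ext: vector_space "\<lambda>a x. \<iota> a * x"
    by (rule field_embedding_vector_space[OF \<iota>])
  obtain B where B: "ext.independent B" "UNIV \<subseteq> ext.span B"
    using ext.basis_exists[of UNIV] by blast
  \<comment> \<open>The cardinality is a positive power, whereas an infinite type would have
    \<open>CARD\<close> equal to 0.\<close>
  have "finite (UNIV :: 'b set)"
    using q card by (intro card_ge_0_finite) simp
  then have finB: "finite B"
    by (rule finite_subset[OF subset_UNIV])
  have span: "ext.span B = UNIV"
    using B by blast
  \<comment> \<open>The locale takes a finite basis as a parameter, hence the choice of
    \<open>B\<close> beforehand.\<close>
  interpret fext: finite_dimensional_vector_space "\<lambda>a x. \<iota> a * x" B
    using finB B span by unfold_locales
  interpret pair: finite_dimensional_vector_space_pair
      "\<lambda>a x. \<iota> a * x" B "(*s) :: 'a \<Rightarrow> 'a ^ 'n \<Rightarrow> 'a ^ 'n" cart_basis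
    by unfold_locales
  have "CARD('a) ^ ext.dim UNIV = CARD('a) ^ vec.dim C"
    using fext.card_subspace[OF ext.subspace_UNIV] card by simp
  then have "ext.dim UNIV = vec.dim C"
    using q by (simp add: power_inject_exp)
  from pair.subspace_isomorphism[OF ext.subspace_UNIV C this]
  obtain f where "Vector_Spaces.linear (\<lambda>a x. \<iota> a * x) (*s) f" "f ` UNIV = C" "inj f"
    by blast
  then show ?thesis
    unfolding extension_iso_def bij_betw_def by blast
qed

section \<open>Minimum distance\<close>

lemma hamming_dist_le: "hamming_dist (u :: 'a ^ 'n::finite) v \<le> CARD('n)"
  unfolding hamming_dist_def by (rule card_mono) auto

text \<open>The code may be infinite here; the distances are still bounded by the length.\<close>

lemma finite_hamming_dists:
  "finite {hamming_dist u v | u v. u \<in> C \<and> v \<in> C \<and> u \<noteq> (v :: 'a ^ 'n::finite)}"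
  by (rule finite_subset[of _ "{..CARD('n)}"]) (auto intro: hamming_dist_le)

lemma min_dist_le:
  assumes "u \<in> C" "v \<in> C" "u \<noteq> v"
  shows "min_dist C \<le> hamming_dist u v"
  unfolding min_dist_def using assms by (intro Min_le finite_hamming_dists) auto

text \<open>The distinct words \<open>u\<close> and \<open>v\<close> make the set of distances
  nonempty, without which its \<open>Min\<close> says nothing.\<close>

lemma min_dist_geI:
  assumes "u \<in> C" "v \<in> C" "u \<noteq> v"
    and "\<And>u v. u \<in> C \<Longrightarrow> v \<in> C \<Longrightarrow> u \<noteq> v \<Longrightarrow> d \<le> hamming_dist u v"
  shows "d \<le> min_dist C"
  unfolding min_dist_def using assms by (subst Min_ge_iff[OF finite_hamming_dists]) auto

section \<open>Concatenation\<close>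

lemma concat_word_nth [simp]: "concat_word \<phi> c $ (j, i) = \<phi> (c $ j) $ i"
  by (simp add: concat_word_def)

lemma concat_code_image: "concat_code \<phi> C = concat_word \<phi> ` C"
  by (auto simp: concat_code_def)

lemma inj_concat_word:
  assumes "inj \<phi>"
  shows "inj (concat_word \<phi>)"
proof (rule injI)
  fix c c' :: "'a ^ 'd"
  assume "concat_word \<phi> c = concat_word \<phi> c'"
  then have "\<phi> (c $ j) $ i = \<phi> (c' $ j) $ i" for j i
    by (metis concat_word_nth)
  then have "\<phi> (c $ j) = \<phi> (c' $ j)" for j
    by (simp add: vec_eq_iff)
  then have "c $ j = c' $ j" for j
    using assms by (simp add: inj_eq)
  then show "c = c'"
    by (simp add: vec_eq_iff)
qed

text \<open>The positions of disagreement form a disjoint union over the blocks \<open>j\<close>,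
  written as a \<open>Sigma\<close> set.\<close>

lemma hamming_dist_concat_word:
  "hamming_dist (concat_word \<phi> c) (concat_word \<phi> c') =
    (\<Sum>j\<in>UNIV. hamming_dist (\<phi> (c $ j)) (\<phi> (c' $ j)))"
proof -
  have "{p. concat_word \<phi> c $ p \<noteq> concat_word \<phi> c' $ p} =
      Sigma UNIV (\<lambda>j. {i. \<phi> (c $ j) $ i \<noteq> \<phi> (c' $ j) $ i})"
    by auto
  then show ?thesis
    by (simp add: hamming_dist_def)
qed

text \<open>Injectivity turns distinct outer symbols into distinct words of \<open>C\<close>, to
  which \<open>min_dist_le\<close> applies; dropping the remaining blocks only lowers the
  sum.\<close>

lemma min_dist_mult_le_hamming_dist_concat_word:
  assumes "inj \<phi>" "range \<phi> \<subseteq> C"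
  shows "min_dist C * hamming_dist c c' \<le> hamming_dist (concat_word \<phi> c) (concat_word \<phi> c')"
proof -
  let ?D = "{j. c $ j \<noteq> c' $ j}"
  have "min_dist C * hamming_dist c c' = (\<Sum>j\<in>?D. min_dist C)"
    by (simp add: hamming_dist_def)
  also have "\<dots> \<le> (\<Sum>j\<in>?D. hamming_dist (\<phi> (c $ j)) (\<phi> (c' $ j)))"
    using assms by (intro sum_mono min_dist_le) (auto simp: inj_eq)
  also have "\<dots> \<le> (\<Sum>j\<in>UNIV. hamming_dist (\<phi> (c $ j)) (\<phi> (c' $ j)))"
    by (intro sum_mono2) auto
  finally show ?thesis
    by (simp add: hamming_dist_concat_word)
qed

lemma has_locality_concat_code:
  fixes \<phi> :: "'b \<Rightarrow> 'a ^ 'n::finite" and C :: "('b ^ 'm::finite) set"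
  assumes "has_locality r C_in" "range \<phi> \<subseteq> C_in"
  shows "has_locality r (concat_code \<phi> C)"
  unfolding has_locality_def
proof
  fix p :: "'m \<times> 'n"
  obtain j i where p: "p = (j, i)"
    by (cases p)
  obtain R where R: "R \<subseteq> UNIV - {i}" "card R \<le> r"
    and agree: "\<And>u v. u \<in> C_in \<Longrightarrow> v \<in> C_in \<Longrightarrow> agree_on (R \<union> {i}) u v \<longleftrightarrow> agree_on R u v"
    using assms(1) unfolding has_locality_def by meson
  \<comment> \<open>Block \<open>j\<close> of a concatenated word is an inner codeword, so agreement
    inside that block is agreement of inner codewords.\<close>
  have block: "agree_on (Pair j ` S) (concat_word \<phi> c) (concat_word \<phi> c') \<longleftrightarrow>
      agree_on S (\<phi> (c $ j)) (\<phi> (c' $ j))" for S and c c' :: "'b ^ 'm"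
    by (simp add: agree_on_def)
  \<comment> \<open>This puts both sides of the locality condition into the form that
    \<open>block\<close> handles.\<close>
  have union: "Pair j ` R \<union> {p} = Pair j ` (R \<union> {i})"
    by (simp add: p)
  have "agree_on (Pair j ` R \<union> {p}) u v \<longleftrightarrow> agree_on (Pair j ` R) u v"
    if words: "u \<in> concat_code \<phi> C" "v \<in> concat_code \<phi> C" for u v
  proof -
    obtain c c' where uv: "u = concat_word \<phi> c" "v = concat_word \<phi> c'"
      using words unfolding concat_code_image by blast
    have "\<phi> (c $ j) \<in> C_in" "\<phi> (c' $ j) \<in> C_in"
      using assms(2) by auto
    then show ?thesis
      unfolding uv union block by (rule agree)
  qed
  moreover have "Pair j ` R \<subseteq> UNIV - {p}"
    using R(1) p by auto
  moreover have "card (Pair j ` R) \<le> r"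
    using R(2) card_image_le[of R "Pair j"] by simp
  ultimately show "\<exists>R\<subseteq>UNIV - {p}. card R \<le> r \<and>
      (\<forall>u\<in>concat_code \<phi> C. \<forall>v\<in>concat_code \<phi> C. agree_on (R \<union> {p}) u v \<longleftrightarrow> agree_on R u v)"
    by blast
qed

text \<open>Scaling a concatenated word by \<open>a\<close> amounts to scaling the outer word by
  \<open>\<iota> a\<close>, and \<open>C\<close> is closed under all scalars of the large
  field.\<close>

lemma subspace_concat_code:
  fixes \<iota> :: "'a::field \<Rightarrow> 'b::field" and \<phi> :: "'b \<Rightarrow> 'a ^ 'n::finite"
    and C :: "('b ^ 'm::finite) set"
  assumes lin: "Vector_Spaces.linear (\<lambda>a x. \<iota> a * x) (*s) \<phi>" and C: "vec.subspace C"
  shows "vec.subspace (concat_code \<phi> C)"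
proof -
  interpret lin: Vector_Spaces.linear "\<lambda>a x. \<iota> a * x" "(*s)" \<phi>
    by (rule lin)
  have zero: "concat_word \<phi> 0 = (0 :: 'a ^ ('m \<times> 'n))"
    by (simp add: vec_eq_iff lin.zero)
  have add: "concat_word \<phi> c + concat_word \<phi> c' = concat_word \<phi> (c + c')" for c c' :: "'b ^ 'm"
    by (simp add: vec_eq_iff lin.add)
  have scale: "a *s concat_word \<phi> c = concat_word \<phi> (\<iota> a *s c)" for a and c :: "'b ^ 'm"
    by (simp add: vec_eq_iff lin.scale)
  show ?thesis
    unfolding concat_code_image
  proof (rule vec.subspaceI)
    show "0 \<in> concat_word \<phi> ` C"
      using vec.subspace_0[OF C] zero by (metis imageI)
  qed (auto simp: add scale vec.subspace_add[OF C] vec.subspace_scale[OF C])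
qed

lemma lrc_ge_concat_code:
  fixes \<iota> :: "'a::field \<Rightarrow> 'b::field" and C_in :: "('a ^ 'n1::finite) set"
    and C_out :: "('b ^ 'n2::finite) set"
  assumes q: "q > 1" and inner: "lrc q n1 k1 d1 r C_in"
    and outer: "linear_code (q ^ k1) n2 k2 d2 C_out"
    and \<phi>: "extension_iso \<iota> C_in \<phi>"
  shows "lrc_ge q (n1 * n2) (k1 * k2) (d1 * d2) r (concat_code \<phi> C_out)"
proof -
  have "CARD('a) = q" "CARD('n1) = n1" "min_dist C_in = d1" "has_locality r C_in"
    using inner by (auto simp: lrc_def linear_code_def linear_code_of_dim_def)
  note inner = this
  have "CARD('b) = q ^ k1" "CARD('n2) = n2" "vec.subspace C_out" "C_out \<noteq> {0}"
    "vec.dim C_out = k2" "min_dist C_out = d2"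
    using outer by (auto simp: linear_code_def linear_code_of_dim_def)
  note outer = this
  have lin: "Vector_Spaces.linear (\<lambda>a x. \<iota> a * x) (*s) \<phi>" and "inj \<phi>" and range: "range \<phi> \<subseteq> C_in"
    using \<phi> by (auto simp: extension_iso_def bij_betw_def)
  let ?C = "concat_code \<phi> C_out"
  have inj: "inj (concat_word \<phi> :: 'b ^ 'n2 \<Rightarrow> _)"
    by (rule inj_concat_word[OF \<open>inj \<phi>\<close>])
  have sub: "vec.subspace ?C"
    by (rule subspace_concat_code[OF lin outer(3)])
  have "q ^ vec.dim ?C = card ?C"
    using vec.card_subspace[OF sub] inner(1) by simp
  also have "\<dots> = card C_out"
    unfolding concat_code_image by (intro card_image inj_on_subset[OF inj]) auto
  \<comment> \<open>The dimension \<open>k2\<close> is taken over the large field, so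
    \<open>C_out\<close> has \<open>(q ^ k1) ^ k2\<close> elements; \<open>q > 1\<close> then allows
    the exponents to be compared.\<close>
  also have "\<dots> = q ^ (k1 * k2)"
    using vec.card_subspace[OF outer(3)] outer by (simp add: power_mult)
  finally have dim: "vec.dim ?C = k1 * k2"
    using q by simp
  have "0 \<in> C_out"
    by (rule vec.subspace_0[OF outer(3)])
  with outer(4) obtain c where c: "c \<in> C_out" "c \<noteq> 0"
    by blast
  \<comment> \<open>These two distinct words serve twice: they show that the code is not
    \<open>{0}\<close>, and they are the pair that \<open>min_dist_geI\<close> asks for.\<close>
  have words: "concat_word \<phi> c \<in> ?C" "concat_word \<phi> 0 \<in> ?C" "concat_word \<phi> c \<noteq> concat_word \<phi> 0"
    using c \<open>0 \<in> C_out\<close> inj by (auto simp: concat_code_image inj_eq)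
  then have "?C \<noteq> {0}"
    by auto
  have "d1 * d2 \<le> min_dist ?C"
  proof (rule min_dist_geI[OF words])
    fix u v
    assume "u \<in> ?C" "v \<in> ?C" "u \<noteq> v"
    then obtain a b where ab: "a \<in> C_out" "b \<in> C_out" "a \<noteq> b"
      and uv: "u = concat_word \<phi> a" "v = concat_word \<phi> b"
      by (auto simp: concat_code_image)
    have "d1 * d2 \<le> d1 * hamming_dist a b"
      using min_dist_le[OF ab] outer(6) by simp
    also have "\<dots> \<le> hamming_dist u v"
      using min_dist_mult_le_hamming_dist_concat_word[OF \<open>inj \<phi>\<close> range] inner(3)
      by (simp add: uv)
    finally show "d1 * d2 \<le> hamming_dist u v" .
  qed
  with sub dim \<open>?C \<noteq> {0}\<close> inner outer show ?thesis
    by (simp add: lrc_ge_def linear_code_ge_def linear_code_of_dim_def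
        has_locality_concat_code[OF _ range])
qed

theorem theorem3p1:
  fixes q n1 k1 d1 r n2 k2 d2 :: nat
    and C_in :: "('a::field ^ 'n1::finite) set"
    and C_out :: "('b::field ^ 'n2::finite) set"
    and \<iota> :: "'a \<Rightarrow> 'b"
  assumes "primepow q"
    and "lrc q n1 k1 d1 r C_in"
    and "linear_code (q ^ k1) n2 k2 d2 C_out"
    and "field_embedding \<iota>"
  shows "(\<exists>\<phi>. extension_iso \<iota> C_in \<phi>) \<and>
    (\<forall>\<phi>. extension_iso \<iota> C_in \<phi> \<longrightarrow>
      lrc_ge q (n1 * n2) (k1 * k2) (d1 * d2) r (concat_code \<phi> C_out))"
proof (intro conjI allI impI)
  have q: "q > 1"
    using primepow_gt_Suc_0[OF assms(1)] by simp
  \<comment> \<open>The outer code fixes \<open>CARD('b) = q ^ k1\<close>, and \<open>k1\<close> is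
    the dimension of \<open>C_in\<close>, which is the cardinality condition of
    \<open>extension_iso_exists\<close>.\<close>
  show "\<exists>\<phi>. extension_iso \<iota> C_in \<phi>"
    using assms q
    by (intro extension_iso_exists)
      (auto simp: lrc_def linear_code_def linear_code_of_dim_def)
  show "lrc_ge q (n1 * n2) (k1 * k2) (d1 * d2) r (concat_code \<phi> C_out)"
    if "extension_iso \<iota> C_in \<phi>" for \<phi>
    by (rule lrc_ge_concat_code[OF q assms(2,3) that])
qed

end
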